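(* Let $(X,\mu)$ be a measure space, let $2<q<\infty$, and let $H$ be a real Hilbert space with inner product $\mathfrak a$, continuously embedded in $L^q(X,\mu)$. Put \[ \mathcal K=\{u\in H:u\ge0\ \mu\text{-a.e.}\},\qquad \mathcal K^\circ=\{w\in H:\mathfrak a(w,v)\le0\ \text{for all }v\in\mathcal K\},\qquad S_H=\inf_{u\in H\setminus\{0\}}\frac{\mathfrak a(u,u)}{\|u\|_{L^q}^2}>0 . \] Then $\mathcal K^\circ\subset-\mathcal K$ if and only if the inverse of the Riesz map of $\mathfrak a$ is positivity preserving. If $\mathcal K^\circ\subset-\mathcal K$, then every sign-changing critical point $u\in H$ of \[ \mathcal E(u)=\tfrac12\mathfrak a(u,u)-\tfrac1q\|u\|_{L^q}^q \] satisfies \[ \mathcal E(u)\ge2\Bigl(\frac12-\frac1q\Bigr)S_H^{q/(q-2)} . \]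
   Context: The Riesz map is $\mathcal R:H\to H'$, $\langle\mathcal Ru,v\rangle=\mathfrak a(u,v)$. Its inverse is positivity preserving if $\mathcal R^{-1}F\in\mathcal K$ for every $F\in H'$ with $\langle F,v\rangle\ge0$ for all $v\in\mathcal K$. A function $u$ is sign-changing if $\mu(\{u>0\})>0$ and $\mu(\{u<0\})>0$. *)

theory Defs
  imports "HOL-Analysis.Analysis"
begin

definition Lq :: "'x measure \<Rightarrow> real \<Rightarrow> ('x \<Rightarrow> real) set" where
  "Lq M q = {f \<in> borel_measurable M. integrable M (\<lambda>x. \<bar>f x\<bar> powr q)}"

definition Lq_norm :: "'x measure \<Rightarrow> real \<Rightarrow> ('x \<Rightarrow> real) \<Rightarrow> real" where
  "Lq_norm M q f = (\<integral>x. \<bar>f x\<bar> powr q \<partial>M) powr (1 / q)"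

text \<open>
  The Hilbert space is a type of class \<^class>\<open>real_inner\<close> and \<^class>\<open>complete_space\<close>,
  its inner product \<open>\<bullet>\<close> being the form \<open>\<aa>\<close>.  The elements of \<open>L\<^sup>q\<close> are classes
  of functions modulo equality almost everywhere; \<open>J u\<close> is a chosen representative of
  the class of \<open>u\<close>, so linearity and injectivity of the embedding are required only modulo
  null sets, and everything below depends on \<open>J u\<close> only up to null sets.
\<close>

definition continuously_embedded_Lq ::
  "'x measure \<Rightarrow> real \<Rightarrow> ('h::{real_inner,complete_space} \<Rightarrow> 'x \<Rightarrow> real) \<Rightarrow> bool" where
  "continuously_embedded_Lq M q J \<longleftrightarrow>
     (\<forall>u. J u \<in> Lq M q) \<and>
     (\<forall>u v. AE x in M. J (u + v) x = J u x + J v x) \<and>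
     (\<forall>c u. AE x in M. J (c *\<^sub>R u) x = c * J u x) \<and>
     (\<forall>u. (AE x in M. J u x = 0) \<longrightarrow> u = 0) \<and>
     (\<exists>C. \<forall>u. Lq_norm M q (J u) \<le> C * norm u)"

definition nonneg_cone :: "'x measure \<Rightarrow> ('h \<Rightarrow> 'x \<Rightarrow> real) \<Rightarrow> 'h set" where
  "nonneg_cone M J = {u. AE x in M. 0 \<le> J u x}"

definition polar_cone :: "'h::real_inner set \<Rightarrow> 'h set" where
  "polar_cone K = {w. \<forall>v\<in>K. w \<bullet> v \<le> 0}"

text \<open>For \<open>H = {0}\<close> the infimum is over the empty set and its value is unspecified.\<close>

definition embedding_const ::
  "'x measure \<Rightarrow> real \<Rightarrow> ('h::real_inner \<Rightarrow> 'x \<Rightarrow> real) \<Rightarrow> real" where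
  "embedding_const M q J = (INF u\<in>UNIV - {0}. (u \<bullet> u) / (Lq_norm M q (J u))\<^sup>2)"

text \<open>
  The dual space is the type of bounded linear functionals.  On a Hilbert space \<open>riesz_map\<close>
  is a bijection by the Riesz representation theorem, so \<open>inv riesz_map\<close> is its genuine inverse.
\<close>

definition riesz_map :: "'h::real_inner \<Rightarrow> ('h \<Rightarrow>\<^sub>L real)" where
  "riesz_map u = Blinfun (\<lambda>v. u \<bullet> v)"

definition positivity_preserving ::
  "'h::real_inner set \<Rightarrow> (('h \<Rightarrow>\<^sub>L real) \<Rightarrow> 'h) \<Rightarrow> bool" where
  "positivity_preserving K T \<longleftrightarrow>
     (\<forall>F. (\<forall>v\<in>K. 0 \<le> blinfun_apply F v) \<longrightarrow> T F \<in> K)"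

definition sign_changing :: "'x measure \<Rightarrow> ('x \<Rightarrow> real) \<Rightarrow> bool" where
  "sign_changing M f \<longleftrightarrow>
     emeasure M {x \<in> space M. f x > 0} > 0 \<and> emeasure M {x \<in> space M. f x < 0} > 0"

definition energy ::
  "'x measure \<Rightarrow> real \<Rightarrow> ('h::real_inner \<Rightarrow> 'x \<Rightarrow> real) \<Rightarrow> 'h \<Rightarrow> real" where
  "energy M q J u = 1 / 2 * (u \<bullet> u) - 1 / q * Lq_norm M q (J u) powr q"

definition critical_point :: "('h::real_normed_vector \<Rightarrow> real) \<Rightarrow> 'h \<Rightarrow> bool" where
  "critical_point f u \<longleftrightarrow> (f has_derivative (\<lambda>_. 0)) (at u)"

lemma blinfun_apply_riesz_map: "blinfun_apply (riesz_map u) v = u \<bullet> v"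
  unfolding riesz_map_def by (simp add: bounded_linear_Blinfun_apply bounded_linear_inner_right)

end

theory Submission
  imports Defs
begin

text \<open>
  Moreau's decomposition writes \<open>u = u\<^sub>1 + u\<^sub>2\<close> with \<open>u\<^sub>1 \<in> K\<close>, \<open>u\<^sub>2 \<in> K\<degree>\<close> and \<open>u\<^sub>1 \<bottom> u\<^sub>2\<close>; the
  hypothesis makes \<open>u\<^sub>2 \<le> 0\<close>, hence \<open>u\<^sub>2 \<le> u \<le> u\<^sub>1\<close>. Testing the critical point equation with
  \<open>u\<^sub>i\<close> gives \<open>\<aa>(u\<^sub>i, u\<^sub>i) = \<integral> \<bar>u\<bar>\<^bsup>q-2\<^esup> u u\<^sub>i \<le> \<integral> \<bar>u\<^sub>i\<bar>\<^bsup>q\<^esup>\<close>, so each \<open>u\<^sub>i\<close> (nonzero as \<open>u\<close> changes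
  sign) has \<open>\<aa>(u\<^sub>i, u\<^sub>i) \<ge> S\<^bsup>q/(q-2)\<^esup>\<close>, and the two contributions add up by orthogonality.
  The critical point equation is obtained without differentiating under the integral: by
  convexity of \<open>\<bar>\<cdot>\<bar>\<^bsup>q\<^esup>\<close> the energy along a line lies below a quadratic touching it at \<open>u\<close>.
\<close>

section \<open>Projections in Hilbert spaces\<close>

text \<open>Completeness gives the point: the parts of \<open>C\<close> within
  \<open>d + 1 / real (Suc n)\<close> of \<open>x\<close> are nested closed nonempty sets whose
  diameters shrink to 0, so they have a common point.\<close>

lemma nearest_point_exists:
  fixes C :: "'h::{real_inner,complete_space} set"
  assumes "closed C" "convex C" "C \<noteq> {}"
  obtains p where "p \<in> C" "\<And>z. z \<in> C \<Longrightarrow> dist x p \<le> dist x z"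
proof -
  define d where "d = infdist x C"
  have d0: "0 \<le> d" and dle: "\<And>z. z \<in> C \<Longrightarrow> d \<le> dist x z"
    unfolding d_def by (auto simp: infdist_nonneg infdist_le)
  define S where "S n = C \<inter> cball x (d + 1 / real (Suc n))" for n
  \<comment> \<open>The midpoint of \<open>y\<close> and \<open>z\<close> lies in \<open>C\<close>,
    hence at distance at least \<open>d\<close> from \<open>x\<close>; the parallelogram law turns
    this into a bound on \<open>dist y z\<close>.\<close>
  have close: "(dist y z)\<^sup>2 \<le> 4 * ((d + e)\<^sup>2 - d\<^sup>2)"
    if "y \<in> C" "z \<in> C" "dist x y \<le> d + e" "dist x z \<le> d + e" for y z e
  proof -
    define m where "m = (1/2) *\<^sub>R y + (1/2) *\<^sub>R z"
    have "m \<in> C"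
      unfolding m_def using assms(2) that by (intro convexD) auto
    then have "d\<^sup>2 \<le> (dist x m)\<^sup>2"
      using dle d0 by (intro power_mono) auto
    moreover have "(dist y z)\<^sup>2 = 2 * (dist x y)\<^sup>2 + 2 * (dist x z)\<^sup>2
        - 4 * (dist x m)\<^sup>2"
      unfolding m_def dist_norm power2_norm_eq_inner
      by (simp add: inner_simps inner_commute algebra_simps)
    moreover have "(dist x y)\<^sup>2 \<le> (d + e)\<^sup>2" "(dist x z)\<^sup>2 \<le> (d + e)\<^sup>2"
      using that by (auto intro: power_mono)
    ultimately show ?thesis
      unfolding right_diff_distrib by (smt (verit))
  qed
  have "\<exists>n. \<forall>y\<in>S n. \<forall>z\<in>S n. dist y z < \<epsilon>" if "0 < \<epsilon>" for \<epsilon>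
  proof -
    have "(\<lambda>n. 4 * ((d + 1 / real (Suc n))\<^sup>2 - d\<^sup>2)) \<longlonglongrightarrow> 4 * ((d + 0)\<^sup>2 - d\<^sup>2)"
      by (intro tendsto_intros LIMSEQ_Suc lim_1_over_n)
    then have "\<forall>\<^sub>F n in sequentially. 4 * ((d + 1 / real (Suc n))\<^sup>2 - d\<^sup>2) < \<epsilon>\<^sup>2"
      using that by (intro order_tendstoD) auto
    then obtain n where n: "4 * ((d + 1 / real (Suc n))\<^sup>2 - d\<^sup>2) < \<epsilon>\<^sup>2"
      by (auto simp: eventually_sequentially)
    show ?thesis
    proof (intro exI[of _ n] ballI)
      fix y z assume "y \<in> S n" "z \<in> S n"
      then have "(dist y z)\<^sup>2 \<le> 4 * ((d + 1 / real (Suc n))\<^sup>2 - d\<^sup>2)"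
        by (intro close) (auto simp: S_def)
      with n have "(dist y z)\<^sup>2 < \<epsilon>\<^sup>2" by linarith
      then show "dist y z < \<epsilon>"
        by (rule power2_less_imp_less) (use that in simp)
    qed
  qed
  moreover have "closed (S n)" for n
    unfolding S_def using assms by auto
  moreover have "S n \<noteq> {}" for n
  proof -
    have "(INF a\<in>C. dist x a) < d + 1 / real (Suc n)"
      using assms(3) by (simp add: d_def infdist_notempty)
    then obtain y where "y \<in> C" "dist x y < d + 1 / real (Suc n)"
      using assms(3) by (subst (asm) cINF_less_iff) auto
    then show ?thesis
      by (auto simp: S_def intro!: exI[of _ y])
  qed
  moreover have "S n \<subseteq> S m" if "m \<le> n" for m n
  proof -
    have "1 / real (Suc n) \<le> 1 / real (Suc m)"
      using that by (simp add: frac_le)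
    then show ?thesis
      unfolding S_def by (intro Int_mono subset_refl subset_cball) auto
  qed
  ultimately obtain p where p: "\<And>n. p \<in> S n"
    using decreasing_closed_nest[of S] by metis
  have "(\<lambda>n. d + 1 / real (Suc n)) \<longlonglongrightarrow> d + 0"
    by (intro tendsto_intros LIMSEQ_Suc lim_1_over_n)
  then have "dist x p \<le> d"
    using p by (intro LIMSEQ_le_const[of _ d]) (auto simp: S_def)
  with p[of 0] dle show ?thesis
    by (intro that[of p]) (auto simp: S_def intro: order_trans)
qed

lemma projection_exists:
  fixes C :: "'h::{real_inner,complete_space} set"
  assumes "closed C" "convex C" "C \<noteq> {}"
  obtains p where "p \<in> C" "\<And>z. z \<in> C \<Longrightarrow> (x - p) \<bullet> (z - p) \<le> 0"
proof -
  obtain p where "p \<in> C" "\<And>z. z \<in> C \<Longrightarrow> dist x p \<le> dist x z"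
    using nearest_point_exists[OF assms] by blast
  then show ?thesis
    by (intro that[of p] any_closest_point_dot[OF assms(2,1)]) auto
qed

lemma Moreau_decomposition:
  fixes K :: "'h::{real_inner,complete_space} set"
  assumes "closed K" "convex_cone K"
  obtains p w where "u = p + w" "p \<in> K" "w \<in> polar_cone K" "p \<bullet> w = 0"
proof -
  have K: "convex K" "K \<noteq> {}" "0 \<in> K" "\<And>c v. v \<in> K \<Longrightarrow> 0 \<le> c \<Longrightarrow> c *\<^sub>R v \<in> K"
    "\<And>v w. v \<in> K \<Longrightarrow> w \<in> K \<Longrightarrow> v + w \<in> K"
    using assms(2) by (simp_all add: convex_cone_contains_0 convex_cone_scaleR
        convex_cone_add convex_cone_nonempty) (simp add: convex_cone_def)
  obtain p where p: "p \<in> K" "\<And>z. z \<in> K \<Longrightarrow> (u - p) \<bullet> (z - p) \<le> 0"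
    using projection_exists[OF assms(1) K(1,2)] by blast
  \<comment> \<open>Testing the variational inequality with 0 and with twice \<open>p\<close> gives
    the two opposite signs.\<close>
  have "(u - p) \<bullet> p = 0"
    using p(2)[OF K(3)] p(2)[OF K(4)[OF p(1), of 2]] by (simp add: scaleR_2)
  moreover have "(u - p) \<bullet> v \<le> 0" if "v \<in> K" for v
    using p(2)[OF K(5)[OF p(1) that]] by simp
  ultimately show ?thesis
    using p(1) by (intro that[of p "u - p"]) (auto simp: polar_cone_def inner_commute)
qed

section \<open>Riesz representation and positivity of the inverse\<close>

lemma bij_riesz_map:
  "bij (riesz_map :: 'h::{real_inner,complete_space} \<Rightarrow> 'h \<Rightarrow>\<^sub>L real)"
proof (intro bijI injI)
  fix u v :: 'h
  assume "riesz_map u = riesz_map v"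
  then have "u \<bullet> (u - v) = v \<bullet> (u - v)"
    by (metis blinfun_apply_riesz_map)
  then have "(u - v) \<bullet> (u - v) = 0"
    by (simp add: inner_diff_left)
  then show "u = v" by simp
next
  show "surj (riesz_map :: 'h \<Rightarrow> 'h \<Rightarrow>\<^sub>L real)"
  proof (unfold surj_def, rule allI)
    fix F :: "'h \<Rightarrow>\<^sub>L real"
    show "\<exists>u. F = riesz_map u"
    proof (cases "F = 0")
      case True
      then show ?thesis
        by (intro exI[of _ 0] blinfun_eqI) (simp add: blinfun_apply_riesz_map)
    next
      case False
      \<comment> \<open>The representer is a multiple of the point of least norm on the hyperplane
        where \<open>F\<close> equals 1, that is, of the projection of the origin onto it.\<close>
      define C where "C = blinfun_apply F -` {1}"
      obtain v where v: "F v \<noteq> 0"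
        using False by (metis blinfun_eqI zero_blinfun.rep_eq)
      have "F ((1 / F v) *\<^sub>R v) = 1"
        using v by (simp add: blinfun.scaleR_right)
      then have "C \<noteq> {}"
        by (auto simp: C_def)
      moreover have "closed C"
        unfolding C_def by (intro continuous_closed_vimage) (auto intro: continuous_intros)
      moreover have "convex C"
        by (auto simp: convex_def C_def blinfun.add_right blinfun.scaleR_right)
      ultimately obtain p where p: "F p = 1" "\<And>z. F z = 1 \<Longrightarrow> (0 - p) \<bullet> (z - p) \<le> 0"
        using projection_exists[of C 0] unfolding C_def by auto
      \<comment> \<open>Both \<open>p + w\<close> and \<open>p - w\<close> lie on the hyperplane, so
        the variational inequality holds with both signs.\<close>
      have orth: "p \<bullet> w = 0" if "F w = 0" for w
        using p(2)[of "p + w"] p(2)[of "p - w"] that p(1)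
        by (simp add: blinfun.add_right blinfun.diff_right)
      have "p \<noteq> 0" using p(1) by (auto simp: blinfun.zero_right)
      \<comment> \<open>The vector \<open>z - F z *\<^sub>R p\<close> is in the kernel of
        \<open>F\<close>, hence orthogonal to \<open>p\<close>.\<close>
      have "F z = ((1 / (p \<bullet> p)) *\<^sub>R p) \<bullet> z" for z
        using orth[of "z - F z *\<^sub>R p"] \<open>p \<noteq> 0\<close> p(1)
        by (simp add: blinfun.diff_right blinfun.scaleR_right inner_diff_right)
      then show ?thesis
        by (intro exI[of _ "(1 / (p \<bullet> p)) *\<^sub>R p"] blinfun_eqI)
           (simp add: blinfun_apply_riesz_map)
    qed
  qed
qed

text \<open>Each functional is \<open>riesz_map w\<close> for exactly one \<open>w\<close>, and it
  is nonnegative on \<open>K\<close> exactly when \<open>- w\<close> is in the polar cone; the two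
  conditions differ only by the sign of \<open>w\<close>.\<close>

lemma polar_cone_subset_iff_positivity_preserving:
  fixes K :: "'h::{real_inner,complete_space} set"
  shows "polar_cone K \<subseteq> uminus ` K \<longleftrightarrow> positivity_preserving K (inv riesz_map)"
proof -
  have "positivity_preserving K (inv riesz_map) \<longleftrightarrow> (\<forall>w. (\<forall>v\<in>K. 0 \<le> w \<bullet> v) \<longrightarrow> w \<in> K)"
    unfolding positivity_preserving_def
    by (metis (no_types, lifting) bij_is_inj bij_is_surj bij_riesz_map
        blinfun_apply_riesz_map inv_f_f surj_f_inv_f)
  also have "\<dots> \<longleftrightarrow> (\<forall>w. (\<forall>v\<in>K. (- w) \<bullet> v \<ge> 0) \<longrightarrow> - w \<in> K)"
    by (metis minus_minus)
  also have "\<dots> \<longleftrightarrow> polar_cone K \<subseteq> uminus ` K"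
    by (force simp: polar_cone_def image_iff)
  finally show ?thesis by blast
qed

section \<open>Pointwise inequalities for powers\<close>

text \<open>For p = q - 1 with q > 1 this is |a|^(q-2) a, the derivative of |a|^q / q, with value 0
  at 0.\<close>

definition signed_powr :: "real \<Rightarrow> real \<Rightarrow> real" where
  "signed_powr p a = sgn a * \<bar>a\<bar> powr p"

text \<open>Young's inequality with conjugate exponents q/(q-1) and q. It yields both an integrable
  majorant and the tangent inequality for |.|^q.\<close>

lemma Young_signed_powr:
  assumes "1 < q"
  shows "\<bar>signed_powr (q - 1) a * b\<bar> \<le> (1 - 1 / q) * \<bar>a\<bar> powr q + 1 / q * \<bar>b\<bar> powr q"
proof -
  have "\<bar>a\<bar> powr (q - 1) * \<bar>b\<bar>
      \<le> (\<bar>a\<bar> powr (q - 1)) powr (q / (q - 1)) / (q / (q - 1)) + \<bar>b\<bar> powr q / q"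
    using assms by (intro Youngs_inequality) (auto simp: field_simps)
  also have "(\<bar>a\<bar> powr (q - 1)) powr (q / (q - 1)) = \<bar>a\<bar> powr q"
    using assms by (simp add: powr_powr)
  finally have *: "\<bar>a\<bar> powr (q - 1) * \<bar>b\<bar> \<le> \<bar>a\<bar> powr q / (q / (q - 1)) + \<bar>b\<bar> powr q / q" .
  have "\<bar>signed_powr (q - 1) a * b\<bar> = \<bar>a\<bar> powr (q - 1) * \<bar>b\<bar>"
    by (simp add: signed_powr_def abs_mult abs_sgn_eq)
  moreover have "c / (q / (q - 1)) = (1 - 1 / q) * c" for c
    using assms by (simp add: field_simps)
  ultimately show ?thesis
    using * by simp
qed

lemma signed_powr_mult_self:
  assumes "0 < p"
  shows "signed_powr (p - 1) a * a = \<bar>a\<bar> powr p"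
proof (cases "a = 0")
  case False
  have "\<bar>a\<bar> powr p = \<bar>a\<bar> powr (p - 1) * \<bar>a\<bar> powr 1"
    by (subst powr_add[symmetric]) simp
  with False show ?thesis
    by (simp add: signed_powr_def sgn_if)
qed (use assms in \<open>simp add: signed_powr_def\<close>)

text \<open>Convexity of |.|^q at \<open>a\<close>, obtained without calculus by applying Young's
  inequality to \<open>a\<close> and \<open>a + v\<close>.\<close>

lemma abs_powr_ge_tangent:
  assumes "1 < q"
  shows "\<bar>a\<bar> powr q + q * (signed_powr (q - 1) a * v) \<le> \<bar>a + v\<bar> powr q"
proof -
  have "signed_powr (q - 1) a * (a + v) \<le> (1 - 1 / q) * \<bar>a\<bar> powr q + 1 / q * \<bar>a + v\<bar> powr q"
    using Young_signed_powr[OF assms, of a "a + v"] by linarith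
  then have "\<bar>a\<bar> powr q + signed_powr (q - 1) a * v
      \<le> (1 - 1 / q) * \<bar>a\<bar> powr q + 1 / q * \<bar>a + v\<bar> powr q"
    using assms by (simp add: distrib_left signed_powr_mult_self)
  then show ?thesis
    using assms by (simp add: field_simps)
qed

text \<open>For positive \<open>a\<close> the power is monotone; otherwise the left side is at most
  0. It serves to compare a critical point with each of its two Moreau components.\<close>

lemma signed_powr_mult_le:
  assumes "1 < p" "0 \<le> b" "a \<le> b"
  shows "signed_powr (p - 1) a * b \<le> \<bar>b\<bar> powr p"
proof (cases "0 < a")
  case True
  then have "a powr (p - 1) * b \<le> b powr (p - 1) * b"
    using assms by (intro mult_right_mono powr_mono2) auto
  also have "b powr (p - 1) * b = \<bar>b\<bar> powr p"
    using True assms signed_powr_mult_self[of p b] by (simp add: signed_powr_def)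
  finally show ?thesis
    using True by (simp add: signed_powr_def)
next
  case False
  then have "signed_powr (p - 1) a * b \<le> 0"
    using assms by (auto simp: signed_powr_def sgn_if mult_nonpos_nonneg)
  then show ?thesis
    by (rule order_trans) simp
qed

lemma signed_powr_minus: "signed_powr p (- a) = - signed_powr p a"
  by (simp add: signed_powr_def sgn_minus)

section \<open>Critical points\<close>

locale Lq_embedding =
  fixes M :: "'x measure" and q :: real
    and J :: "'h::{real_inner,complete_space} \<Rightarrow> 'x \<Rightarrow> real"
  assumes q: "2 < q" and embedded: "continuously_embedded_Lq M q J"
begin

abbreviation "K \<equiv> nonneg_cone M J"
abbreviation "S \<equiv> embedding_const M q J"

lemma J_in_Lq: "J u \<in> Lq M q"
  and J_add: "AE x in M. J (u + v) x = J u x + J v x"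
  and J_scaleR: "AE x in M. J (c *\<^sub>R u) x = c * J u x"
  and J_eq_0: "AE x in M. J u x = 0 \<Longrightarrow> u = 0"
  using embedded[unfolded continuously_embedded_Lq_def] by (elim conjE; metis)+

lemma J_measurable [measurable]: "J u \<in> borel_measurable M"
  and integrable_J: "integrable M (\<lambda>x. \<bar>J u x\<bar> powr q)"
  using J_in_Lq[of u] by (simp_all add: Lq_def)

lemma J_bounded: obtains C where "0 < C" "\<And>u. Lq_norm M q (J u) \<le> C * norm u"
proof -
  have "\<exists>C. \<forall>u. Lq_norm M q (J u) \<le> C * norm u"
    using embedded unfolding continuously_embedded_Lq_def by (elim conjE)
  then obtain C where C: "\<And>u. Lq_norm M q (J u) \<le> C * norm u"
    by (elim exE) (rule that, erule spec)
  \<comment> \<open>Raising the constant to at least 1 makes it positive, so that one may divide by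
    it.\<close>
  have "Lq_norm M q (J u) \<le> max C 1 * norm u" for u
    by (rule order_trans[OF C mult_right_mono]) auto
  then show ?thesis
    by (rule that[rotated]) simp
qed

lemma J_minus: "AE x in M. J (- u) x = - J u x"
  using J_scaleR[of "-1" u] by simp

lemma J_diff: "AE x in M. J (u - v) x = J u x - J v x"
  using J_add[of u "- v"] J_minus[of v] by eventually_elim simp

lemma Lq_norm_powr: "Lq_norm M q (J u) powr q = (\<integral>x. \<bar>J u x\<bar> powr q \<partial>M)"
  using q by (simp add: Lq_norm_def powr_powr integral_nonneg)

section \<open>The embedding constant\<close>

lemma Lq_norm_pos: "u \<noteq> 0 \<Longrightarrow> 0 < Lq_norm M q (J u)"
proof (rule ccontr)
  assume "u \<noteq> 0" "\<not> 0 < Lq_norm M q (J u)"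
  then have "(\<integral>x. \<bar>J u x\<bar> powr q \<partial>M) = 0"
    by (simp add: Lq_norm_def)
  then have "AE x in M. J u x = 0"
    by (subst (asm) integral_nonneg_eq_0_iff_AE) (auto simp: integrable_J)
  with J_eq_0 \<open>u \<noteq> 0\<close> show False by blast
qed

text \<open>A bound \<open>C\<close> for the embedding bounds every quotient below by
  \<open>1 / C\<^sup>2\<close>; the nonzero \<open>u\<close> keeps the infimum from running over the
  empty set.\<close>

lemma embedding_const_pos:
  assumes "u \<noteq> (0::'h)"
  shows "0 < S"
proof -
  obtain C where C: "0 < C" "\<And>u. Lq_norm M q (J u) \<le> C * norm u"
    using J_bounded by blast
  have "1 / C\<^sup>2 \<le> (v \<bullet> v) / (Lq_norm M q (J v))\<^sup>2" if "v \<noteq> 0" for v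
  proof -
    have "(Lq_norm M q (J v))\<^sup>2 \<le> (C * norm v)\<^sup>2"
      using C(2)[of v] Lq_norm_pos[OF that] by (intro power_mono) auto
    then show ?thesis
      using C(1) Lq_norm_pos[OF that]
      by (simp add: field_simps power_mult_distrib power2_norm_eq_inner)
  qed
  then have "1 / C\<^sup>2 \<le> S"
    unfolding embedding_const_def using assms by (intro cINF_greatest) auto
  moreover have "0 < 1 / C\<^sup>2"
    using C(1) by simp
  ultimately show ?thesis by linarith
qed

lemma embedding_const_le: "S * (Lq_norm M q (J u))\<^sup>2 \<le> u \<bullet> u"
proof (cases "u = 0")
  case True
  \<comment> \<open>Here \<open>S\<close> may be the unspecified infimum over the empty set; its
    value is harmless because it is multiplied by a zero norm.\<close>
  have "AE x in M. \<bar>J 0 x\<bar> powr q = 0"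
    using J_scaleR[of 0 0] by eventually_elim simp
  then have "(\<integral>x. \<bar>J 0 x\<bar> powr q \<partial>M) = 0"
    by (subst integral_cong_AE[of _ _ "\<lambda>_. 0"]) auto
  with True show ?thesis
    by (simp add: Lq_norm_def)
next
  case False
  have "S \<le> (u \<bullet> u) / (Lq_norm M q (J u))\<^sup>2"
    unfolding embedding_const_def using False
    by (intro cINF_lower bdd_belowI[of _ 0]) auto
  then show ?thesis
    using Lq_norm_pos[OF False] by (simp add: field_simps)
qed

text \<open>With N the \<open>L^q\<close> norm, S N^2 \<le> \<open>u \<bullet> u\<close> \<le> N^q
  forces S \<le> N^(q-2), so N^2 is at least S^(2/(q-2)). Inserting this into the first inequality
  gives the exponent 1 + 2/(q-2) = q/(q-2).\<close>

lemma embedding_const_powr_le: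
  assumes "u \<noteq> 0" "u \<bullet> u \<le> (\<integral>x. \<bar>J u x\<bar> powr q \<partial>M)"
  shows "S powr (q / (q - 2)) \<le> u \<bullet> u"
proof -
  let ?N = "Lq_norm M q (J u)"
  have N: "0 < ?N" and S: "0 < S"
    using Lq_norm_pos embedding_const_pos assms(1) by auto
  have "S * ?N powr 2 \<le> ?N powr q"
    using embedding_const_le[of u] assms(2) N by (simp add: Lq_norm_powr)
  also have "?N powr q = ?N powr (q - 2) * ?N powr 2"
    by (simp flip: powr_add)
  finally have "S \<le> ?N powr (q - 2)"
    using N by simp
  then have "S powr (2 / (q - 2)) \<le> (?N powr (q - 2)) powr (2 / (q - 2))"
    using S q by (intro powr_mono2) auto
  moreover have "(q - 2) * (2 / (q - 2)) = 2"
    using q by (simp only: times_divide_eq_right nonzero_mult_div_cancel_left)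
  ultimately have "S powr (2 / (q - 2)) \<le> ?N\<^sup>2"
    using N by (simp only: powr_powr powr_numeral)
  then have "S * S powr (2 / (q - 2)) \<le> u \<bullet> u"
    using S embedding_const_le[of u] by (meson less_eq_real_def mult_left_mono order_trans)
  moreover have "q / (q - 2) = 1 + 2 / (q - 2)"
    using q by (simp add: field_simps)
  ultimately show ?thesis
    using S by (simp add: powr_add)
qed

section \<open>The nonnegative elements form a closed convex cone\<close>

lemma convex_cone_nonneg_cone: "convex_cone K"
proof -
  have "0 \<in> K"
    using J_scaleR[of 0 0] by (auto simp: nonneg_cone_def elim!: eventually_mono)
  moreover have "u + v \<in> K" if "u \<in> K" "v \<in> K" for u v
    using that J_add[of u v] unfolding nonneg_cone_def mem_Collect_eq
    by eventually_elim simp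
  moreover have "c *\<^sub>R u \<in> K" if "u \<in> K" "0 \<le> c" for u c
    using that J_scaleR[of c u] unfolding nonneg_cone_def mem_Collect_eq
    by (auto elim: eventually_elim2)
  ultimately show ?thesis
    by (auto simp: convex_cone_iff)
qed

lemma closed_nonneg_cone: "closed K"
  unfolding closed_sequential_limits
proof (intro allI impI, elim conjE)
  fix f l assume f: "\<forall>n. f n \<in> K" "f \<longlonglongrightarrow> l"
  obtain C where C: "0 < C" "\<And>u. Lq_norm M q (J u) \<le> C * norm u"
    using J_bounded by blast
  \<comment> \<open>The negative part of the limit has to vanish: wherever \<open>J (f n)\<close> is
    nonnegative, \<open>neg\<close> is at most the absolute value of \<open>J (f n - l)\<close>,
    whose \<open>L^q\<close> norm tends to 0.\<close>
  define neg where "neg x = max 0 (- J l x)" for x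
  have neg_le: "neg x powr q \<le> \<bar>J l x\<bar> powr q" for x
    using q by (intro powr_mono2) (auto simp: neg_def)
  have int: "integrable M (\<lambda>x. neg x powr q)"
    by (rule Bochner_Integration.integrable_bound[OF integrable_J[of l]])
       (use neg_le in \<open>auto simp: neg_def\<close>)
  have "(\<integral>x. neg x powr q \<partial>M) \<le> (C * norm (f n - l)) powr q" for n
  proof -
    have "AE x in M. 0 \<le> J (f n) x"
      using f(1) by (simp add: nonneg_cone_def)
    then have "AE x in M. neg x powr q \<le> \<bar>J (f n - l) x\<bar> powr q"
      using J_diff[of "f n" l]
    proof eventually_elim
      case (elim x)
      then show ?case using q by (intro powr_mono2) (auto simp: neg_def)
    qed
    then have "(\<integral>x. neg x powr q \<partial>M) \<le> (\<integral>x. \<bar>J (f n - l) x\<bar> powr q \<partial>M)"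
      by (intro integral_mono_AE int integrable_J)
    also have "\<dots> = Lq_norm M q (J (f n - l)) powr q"
      by (simp add: Lq_norm_powr)
    also have "\<dots> \<le> (C * norm (f n - l)) powr q"
      using q C by (intro powr_mono2) (auto simp: Lq_norm_def)
    finally show ?thesis .
  qed
  moreover have "(\<lambda>n. (C * norm (f n - l)) powr q) \<longlonglongrightarrow> (C * norm (l - l)) powr q"
    using q C f(2) by (intro tendsto_powr' tendsto_intros) auto
  ultimately have "(\<integral>x. neg x powr q \<partial>M) \<le> 0"
    by (intro LIMSEQ_le_const) auto
  moreover have "0 \<le> (\<integral>x. neg x powr q \<partial>M)"
    by (simp add: integral_nonneg)
  ultimately have "AE x in M. neg x powr q = 0"
    using integral_nonneg_eq_0_iff_AE[OF int] by auto
  then show "l \<in> K"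
    by (auto simp: nonneg_cone_def neg_def elim!: eventually_mono)
qed

section \<open>The weak equation of a critical point\<close>

lemma integrable_signed_powr: "integrable M (\<lambda>x. signed_powr (q - 1) (J u x) * J v x)"
proof (rule Bochner_Integration.integrable_bound)
  show "integrable M (\<lambda>x. (1 - 1 / q) * \<bar>J u x\<bar> powr q + 1 / q * \<bar>J v x\<bar> powr q)"
    by (intro Bochner_Integration.integrable_add integrable_mult_right integrable_J)
  show "(\<lambda>x. signed_powr (q - 1) (J u x) * J v x) \<in> borel_measurable M"
    unfolding signed_powr_def by measurable
  show "AE x in M. norm (signed_powr (q - 1) (J u x) * J v x)
      \<le> norm ((1 - 1 / q) * \<bar>J u x\<bar> powr q + 1 / q * \<bar>J v x\<bar> powr q)"
    using Young_signed_powr[of q] q by (intro always_eventually allI) (smt (verit) real_norm_def)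
qed

text \<open>For fixed \<open>v\<close> the function \<open>h\<close> is nonnegative, vanishes at 0
  and has derivative \<open>u \<bullet> v - I\<close> there, so this number is 0.\<close>

lemma critical_point_equation:
  assumes "critical_point (energy M q J) u"
  shows "u \<bullet> v = (\<integral>x. signed_powr (q - 1) (J u x) * J v x \<partial>M)"
proof -
  define I where "I = (\<integral>x. signed_powr (q - 1) (J u x) * J v x \<partial>M)"
  \<comment> \<open>Replacing |.|^q by its tangent at \<open>J u\<close> makes the energy along the
    line a quadratic in \<open>t\<close> lying above it; \<open>h\<close> is the gap.\<close>
  define h where "h t = energy M q J u + t * (u \<bullet> v - I) + t\<^sup>2 / 2 * (v \<bullet> v)
      - energy M q J (u + t *\<^sub>R v)" for t
  have "0 \<le> h t" for t
  proof -
    have "AE x in M. \<bar>J u x\<bar> powr q + q * t * (signed_powr (q - 1) (J u x) * J v x)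
        \<le> \<bar>J (u + t *\<^sub>R v) x\<bar> powr q"
      using J_add[of u "t *\<^sub>R v"] J_scaleR[of t v]
    proof eventually_elim
      case (elim x)
      then have eq: "J (u + t *\<^sub>R v) x = J u x + t * J v x"
        by simp
      have "q * t * (signed_powr (q - 1) (J u x) * J v x)
          = q * (signed_powr (q - 1) (J u x) * (t * J v x))"
        by (rule mult.assoc[THEN trans]) (simp only: mult.left_commute)
      then show ?case
        using abs_powr_ge_tangent[of q "J u x" "t * J v x"] q unfolding eq by linarith
    qed
    then have "(\<integral>x. \<bar>J u x\<bar> powr q + q * t * (signed_powr (q - 1) (J u x) * J v x) \<partial>M)
        \<le> (\<integral>x. \<bar>J (u + t *\<^sub>R v) x\<bar> powr q \<partial>M)"
      by (intro integral_mono_AE Bochner_Integration.integrable_add integrable_mult_right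
          integrable_J integrable_signed_powr)
    also have "(\<integral>x. \<bar>J u x\<bar> powr q + q * t * (signed_powr (q - 1) (J u x) * J v x) \<partial>M)
        = (\<integral>x. \<bar>J u x\<bar> powr q \<partial>M) + q * t * I"
      unfolding I_def
      by (subst Bochner_Integration.integral_add)
         (auto intro!: integrable_mult_right integrable_J integrable_signed_powr)
    finally have "1 / q * ((\<integral>x. \<bar>J u x\<bar> powr q \<partial>M) + q * t * I)
        \<le> 1 / q * (\<integral>x. \<bar>J (u + t *\<^sub>R v) x\<bar> powr q \<partial>M)"
      using q by (intro mult_left_mono) auto
    then have "1 / q * (\<integral>x. \<bar>J u x\<bar> powr q \<partial>M) + t * I
        \<le> 1 / q * (\<integral>x. \<bar>J (u + t *\<^sub>R v) x\<bar> powr q \<partial>M)"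
      using q by (simp add: distrib_left)
    moreover have "(u + t *\<^sub>R v) \<bullet> (u + t *\<^sub>R v) = u \<bullet> u + 2 * t * (u \<bullet> v) + t\<^sup>2 * (v \<bullet> v)"
      by (simp add: inner_simps inner_commute power2_eq_square)
    ultimately show ?thesis
      unfolding h_def energy_def Lq_norm_powr by (simp add: algebra_simps)
  qed
  moreover have "h 0 = 0"
    by (simp add: h_def)
  moreover have "(h has_real_derivative (u \<bullet> v - I)) (at 0)"
  proof -
    \<comment> \<open>Criticality enters here: the energy contributes slope 0, leaving only the
      linear term of the quadratic.\<close>
    have "((\<lambda>t. energy M q J (u + t *\<^sub>R v)) has_derivative (\<lambda>_. 0)) (at 0)"
    proof (rule has_derivative_compose[of "\<lambda>t. u + t *\<^sub>R v" "\<lambda>t. t *\<^sub>R v"])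
      show "((\<lambda>t. u + t *\<^sub>R v) has_derivative (\<lambda>t. t *\<^sub>R v)) (at 0)"
        by (auto intro!: derivative_eq_intros)
      show "(energy M q J has_derivative (\<lambda>_. 0)) (at (u + 0 *\<^sub>R v))"
        using assms by (simp add: critical_point_def)
    qed
    then have "((\<lambda>t. energy M q J (u + t *\<^sub>R v)) has_real_derivative 0) (at 0)"
      by (rule has_derivative_imp_has_field_derivative) simp
    then show ?thesis
      unfolding h_def by (auto intro!: derivative_eq_intros)
  qed
  ultimately have "u \<bullet> v - I = 0"
    by (intro DERIV_local_min[of h _ 0 1]) auto
  then show ?thesis
    by (simp add: I_def)
qed

section \<open>Energy of critical points\<close>

lemma critical_energy:
  assumes "critical_point (energy M q J) u"
  shows "energy M q J u = (1 / 2 - 1 / q) * (u \<bullet> u)"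
proof -
  \<comment> \<open>Testing with \<open>u\<close> itself equates the quadratic term with the
    integral in the energy.\<close>
  have "u \<bullet> u = (\<integral>x. \<bar>J u x\<bar> powr q \<partial>M)"
    using critical_point_equation[OF assms, of u] q by (simp add: signed_powr_mult_self)
  then show ?thesis
    by (simp add: energy_def Lq_norm_powr algebra_simps)
qed

text \<open>Testing the equation with \<open>v\<close> integrates the pointwise bound into the
  hypothesis of \<open>embedding_const_powr_le\<close>. The condition
  \<open>u \<bullet> v = v \<bullet> v\<close> holds for each of two orthogonal summands of
  \<open>u\<close>.\<close>

lemma critical_component_bound:
  assumes crit: "critical_point (energy M q J) u"
    and "v \<noteq> 0" "u \<bullet> v = v \<bullet> v"
    and "AE x in M. signed_powr (q - 1) (J u x) * J v x \<le> \<bar>J v x\<bar> powr q"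
  shows "S powr (q / (q - 2)) \<le> v \<bullet> v"
proof (rule embedding_const_powr_le[OF assms(2)])
  show "v \<bullet> v \<le> (\<integral>x. \<bar>J v x\<bar> powr q \<partial>M)"
    unfolding assms(3)[symmetric] critical_point_equation[OF crit]
    by (intro integral_mono_AE integrable_signed_powr integrable_J assms(4))
qed

lemma sign_changing_critical_energy:
  assumes polar: "polar_cone K \<subseteq> uminus ` K"
    and sc: "sign_changing M (J u)" and crit: "critical_point (energy M q J) u"
  shows "energy M q J u \<ge> 2 * (1 / 2 - 1 / q) * S powr (q / (q - 2))"
proof -
  obtain p w where u: "u = p + w" and p: "p \<in> K" and w: "w \<in> polar_cone K" and pw: "p \<bullet> w = 0"
    using Moreau_decomposition[OF closed_nonneg_cone convex_cone_nonneg_cone] by blast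
  from w polar obtain w' where "w' \<in> K" "w = - w'" by blast
  then have w_neg: "AE x in M. J w x \<le> 0"
    using J_minus[of w'] by (auto simp: nonneg_cone_def elim: eventually_elim2)
  have p_pos: "AE x in M. 0 \<le> J p x"
    using p by (simp add: nonneg_cone_def)
  have u_eq: "AE x in M. J u x = J p x + J w x"
    using J_add u by simp
  \<comment> \<open>Otherwise \<open>u = w\<close> would be nonpositive almost everywhere;
    symmetrically, \<open>w = 0\<close> would make \<open>u\<close> nonnegative.\<close>
  have "p \<noteq> 0"
  proof
    assume "p = 0"
    then have "AE x in M. \<not> 0 < J u x"
      using w_neg u by (auto elim: eventually_mono)
    then have "emeasure M {x \<in> space M. 0 < J u x} = 0"
      by (intro emeasure_eq_0_AE) simp
    with sc show False by (simp add: sign_changing_def)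
  qed
  have "w \<noteq> 0"
  proof
    assume "w = 0"
    then have "AE x in M. \<not> J u x < 0"
      using p_pos u by (auto elim: eventually_mono)
    then have "emeasure M {x \<in> space M. J u x < 0} = 0"
      by (intro emeasure_eq_0_AE) simp
    with sc show False by (simp add: sign_changing_def)
  qed
  have "AE x in M. signed_powr (q - 1) (J u x) * J p x \<le> \<bar>J p x\<bar> powr q"
    using p_pos w_neg u_eq
  proof eventually_elim
    case (elim x)
    then show ?case using q by (intro signed_powr_mult_le) auto
  qed
  then have "S powr (q / (q - 2)) \<le> p \<bullet> p"
    using \<open>p \<noteq> 0\<close> pw
    by (intro critical_component_bound[OF crit]) (auto simp: u inner_simps inner_commute)
  \<comment> \<open>The reflected case: \<open>signed_powr\<close> is odd, and almost everywhere
    \<open>- J w x\<close> is nonnegative and at least \<open>- J u x\<close>, because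
    \<open>J p x\<close> is nonnegative.\<close>
  moreover have "AE x in M. signed_powr (q - 1) (J u x) * J w x \<le> \<bar>J w x\<bar> powr q"
    using p_pos w_neg u_eq
  proof eventually_elim
    case (elim x)
    then show ?case
      using signed_powr_mult_le[of q "- J w x" "- J u x"] q
      unfolding signed_powr_minus by simp
  qed
  then have "S powr (q / (q - 2)) \<le> w \<bullet> w"
    using \<open>w \<noteq> 0\<close> pw
    by (intro critical_component_bound[OF crit]) (auto simp: u inner_simps inner_commute)
  moreover have "u \<bullet> u = p \<bullet> p + w \<bullet> w"
    using pw by (simp add: u inner_simps inner_commute)
  \<comment> \<open>Pythagoras adds the two bounds, and q > 2 makes the factor 1/2 - 1/q
    positive.\<close>
  ultimately have "(1 / 2 - 1 / q) * (2 * S powr (q / (q - 2))) \<le> (1 / 2 - 1 / q) * (u \<bullet> u)"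
    using q by (intro mult_left_mono) (auto simp: field_simps)
  then show ?thesis
    unfolding critical_energy[OF crit] by (simp only: mult_ac)
qed

end

theorem theorem3:
  fixes M :: "'x measure"
    and q :: real
    and J :: "'h::{real_inner,complete_space} \<Rightarrow> 'x \<Rightarrow> real"
  assumes "2 < q"
    and "continuously_embedded_Lq M q J"
  shows "((\<exists>u::'h. u \<noteq> 0) \<longrightarrow> 0 < embedding_const M q J) \<and>
    (polar_cone (nonneg_cone M J) \<subseteq> uminus ` nonneg_cone M J \<longleftrightarrow>
       positivity_preserving (nonneg_cone M J) (inv riesz_map)) \<and>
    (polar_cone (nonneg_cone M J) \<subseteq> uminus ` nonneg_cone M J \<longrightarrow>
       (\<forall>u. sign_changing M (J u) \<and> critical_point (energy M q J) u \<longrightarrow>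
          energy M q J u \<ge> 2 * (1 / 2 - 1 / q) * embedding_const M q J powr (q / (q - 2))))"
proof -
  interpret Lq_embedding M q J
    using assms by unfold_locales
  show ?thesis
  proof (intro conjI impI allI polar_cone_subset_iff_positivity_preserving)
    assume "\<exists>u::'h. u \<noteq> 0"
    then show "0 < embedding_const M q J"
      using embedding_const_pos by (elim exE)
  next
    fix u
    assume "polar_cone (nonneg_cone M J) \<subseteq> uminus ` nonneg_cone M J"
      and "sign_changing M (J u) \<and> critical_point (energy M q J) u"
    then show "energy M q J u
        \<ge> 2 * (1 / 2 - 1 / q) * embedding_const M q J powr (q / (q - 2))"
      by (elim conjE) (rule sign_changing_critical_energy)
  qed
qed

end
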